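(* Let $n \ge 5$ be an odd integer. Then the Kronecker product $C_n \otimes C_n$ has diameter $n-1$, is not distance-regular, and has exactly $\frac{n+3}{2}$ distinct distance eigenvalues. Since $\frac{n+3}{2} < n$, the graph $C_n\otimes C_n$ has fewer than $d+1$ distinct distance eigenvalues, where $d = n-1$ is its diameter. Consequently the graphs $C_n \otimes C_n$, $n\ge 5$ odd, form an infinite family of non-distance-regular connected graphs of diameter $d$ with fewer than $d+1$ distinct distance eigenvalues.
   Context: $C_n$ denotes the cycle on $n$ vertices. For graphs $G$ and $H$, the Kronecker (direct) product $G\otimes H$ has vertex set $V(G)\times V(H)$, with $(x,y)\sim(x',y')$ if $x\sim x'$ in $G$ and $y\sim y'$ in $H$. For a connected graph $G$ with vertices $v_1,\dots,v_N$, $d(u,v)$ denotes the length of a shortest path between $u$ and $v$; the distance matrix is $D(G)=(d(v_i,v_j))_{N\times N}$, and the distance eigenvalues of $G$ are the eigenvalues of $D(G)$. For a vertex $x$, let $G_i(x)$ be the set of vertices at distance $i$ from $x$. A connected graph $G$ is distance-regular if it is regular and, for each $i$, there are constants $c_i$ and $b_i$ such that for any two vertices $x,y$ at distance $i$ there are precisely $c_i$ neighbors of $y$ in $G_{i-1}(x)$ and $b_i$ neighbors of $y$ in $G_{i+1}(x)$. *)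

theory Defs
  imports "Graph_Theory.Graph_Theory" "Jordan_Normal_Form.Char_Poly"
begin

text \<open>Simple graphs are the \<^locale>\<open>pair_graph\<close>s: finite symmetric loop-free sets of arcs.\<close>

text \<open>The definition yields the cycle on \<open>n\<close> vertices for \<open>n \<ge> 3\<close>.\<close>

definition cycle_graph :: "nat \<Rightarrow> nat pair_pre_digraph" where
  "cycle_graph n =
     \<lparr> pverts = {0..<n},
       parcs = {(i, j). i < n \<and> j < n \<and> (j = Suc i mod n \<or> i = Suc j mod n)} \<rparr>"

definition kronecker_product ::
    "'a pair_pre_digraph \<Rightarrow> 'b pair_pre_digraph \<Rightarrow> ('a \<times> 'b) pair_pre_digraph"
    (infixl \<open>\<otimes>\<^sub>K\<close> 70) where
  "G \<otimes>\<^sub>K H =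
     \<lparr> pverts = pverts G \<times> pverts H,
       parcs = {((x, y), (x', y')) | x y x' y'. (x, x') \<in> parcs G \<and> (y, y') \<in> parcs H} \<rparr>"

text \<open>\<open>pre_digraph.apath\<close> is the library's notion of a path, given by its list of arcs.
  The value is meaningful only if \<open>v\<close> is reachable from \<open>u\<close>.\<close>

definition graph_dist :: "'a pair_pre_digraph \<Rightarrow> 'a \<Rightarrow> 'a \<Rightarrow> nat" where
  "graph_dist G u v = (LEAST k. \<exists>p. pre_digraph.apath (with_proj G) u p v \<and> length p = k)"

definition graph_diameter :: "'a pair_pre_digraph \<Rightarrow> nat" where
  "graph_diameter G = Max {graph_dist G u v | u v. u \<in> pverts G \<and> v \<in> pverts G}"

text \<open>The index of a distance layer is an integer, so that the layer of index \<open>-1\<close> is empty.\<close>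

definition dist_layer :: "'a pair_pre_digraph \<Rightarrow> int \<Rightarrow> 'a \<Rightarrow> 'a set" where
  "dist_layer G i x = {v \<in> pverts G. int (graph_dist G x v) = i}"

definition neighbors :: "'a pair_pre_digraph \<Rightarrow> 'a \<Rightarrow> 'a set" where
  "neighbors G y = {z \<in> pverts G. (y, z) \<in> parcs G}"

definition regular_graph :: "'a pair_pre_digraph \<Rightarrow> bool" where
  "regular_graph G \<longleftrightarrow> (\<exists>k. \<forall>v\<in>pverts G. card (neighbors G v) = k)"

definition distance_regular :: "'a pair_pre_digraph \<Rightarrow> bool" where
  "distance_regular G \<longleftrightarrow>
     Digraph_Component.connected (with_proj G) \<and> regular_graph G \<and>
     (\<forall>i::nat. \<exists>c b. \<forall>x\<in>pverts G. \<forall>y\<in>pverts G. graph_dist G x y = i \<longrightarrow>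
        card (neighbors G y \<inter> dist_layer G (int i - 1) x) = c \<and>
        card (neighbors G y \<inter> dist_layer G (int i + 1) x) = b)"

definition vertex_enumeration :: "'a pair_pre_digraph \<Rightarrow> 'a list \<Rightarrow> bool" where
  "vertex_enumeration G vs \<longleftrightarrow> distinct vs \<and> set vs = pverts G"

definition distance_matrix :: "'a pair_pre_digraph \<Rightarrow> 'a list \<Rightarrow> real mat" where
  "distance_matrix G vs =
     mat (length vs) (length vs) (\<lambda>(i, j). real (graph_dist G (vs ! i) (vs ! j)))"

text \<open>Matrices are indexed by numbers, hence the enumeration \<open>vs\<close> of the vertices.  The matrix is
  real symmetric, so that the real eigenvalues are all the eigenvalues.\<close>

definition distance_eigenvalues :: "'a pair_pre_digraph \<Rightarrow> 'a list \<Rightarrow> real set" where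
  "distance_eigenvalues G vs = {k. eigenvalue (distance_matrix G vs) k}"

definition odd_cycle_squares :: "(nat \<times> nat) pair_pre_digraph set" where
  "odd_cycle_squares = {cycle_graph n \<otimes>\<^sub>K cycle_graph n | n. odd n \<and> n \<ge> 5}"

end

(*
  For odd n the residue 2 is invertible modulo n, so (x, y) |-> ((x + y)/2, (x - y)/2) turns the
  steps (+-1, +-1) of the Kronecker square of C_n into the steps (+-1, 0), (0, +-1) of the Cartesian
  square.  Hence the distance of two vertices is |u| + |v|, where |.| is the distance to 0 in C_n and
  (u, v) are the rotated coordinates of their difference.  The maximum is 2 (n - 1)/2 = n - 1, and
  the points (u, v) = (2, 0) and (1, 1) at distance 2 from the origin have one and two neighbours
  at distance 1, so the graph is not distance-regular.

  The distance matrix is invariant under translations, so its eigenvalues are the values of the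
  Fourier transform of |u| + |v| on (Z/n)^2.  That transform vanishes off the two axes of the rotated
  dual group.  At the origin it is positive, and on the axes it is n times the Fourier transform of
  |.|, which is evaluated through the second difference of |.|: at 2a it is
  -1 / (2 + 2 cos(2 pi a / n)).  This gives (n - 1)/2 distinct negative values, besides 0 and the
  positive one.
*)
theory Submission
  imports Defs "HOL-Number_Theory.Cong"
begin

section \<open>Distances from potentials\<close>

text \<open>Each step of the loop erasure cuts out a closed subwalk. This links the walks built
  below to \<open>graph_dist\<close>, which minimises over paths.\<close>

lemma (in wf_digraph) length_awalk_to_apath_le:
  assumes "awalk u p v"
  shows "length (awalk_to_apath p) \<le> length p"
  using assms
proof (induct rule: awalk_to_apath_induct)
  case (path p)
  then have "awalk_to_apath p = p"
    by (auto simp: awalk_to_apath.simps)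
  then show ?case by simp
next
  case (decomp p q r s)
  have "p = q @ r @ s" using awalk_cyc_decomp_has_prop[OF decomp(1,3)] decomp(2) by simp
  moreover have "awalk_to_apath p = awalk_to_apath (q @ s)"
    using step_awalk_to_apath[OF decomp(1-3)] .
  ultimately show ?case using decomp(4) by simp
qed

lemma (in pair_graph) awalk_potential_le:
  fixes f :: "'a \<Rightarrow> nat"
  assumes "awalk a p v" and "\<And>y z. (y, z) \<in> parcs G \<Longrightarrow> f z \<le> f y + 1"
  shows "f v \<le> f a + length p"
  using assms(1)
proof (induct p arbitrary: a)
  case Nil
  then show ?case by (simp add: awalk_Nil_iff)
next
  case (Cons e p)
  obtain y z where e: "e = (y, z)" by (cases e)
  with Cons.prems have "(y, z) \<in> parcs G" "a = y" "awalk z p v"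
    by (auto simp: awalk_Cons_iff)
  then show ?case using Cons.hyps[of z] assms(2)[of y z] by simp
qed

context pair_graph
begin

context
  fixes f :: "'a \<Rightarrow> nat" and u
  assumes u: "u \<in> pverts G"
    and zero: "\<And>v. v \<in> pverts G \<Longrightarrow> f v = 0 \<longleftrightarrow> v = u"
    and lip: "\<And>y z. (y, z) \<in> parcs G \<Longrightarrow> f z \<le> f y + 1"
    and pred: "\<And>v. v \<in> pverts G \<Longrightarrow> f v \<noteq> 0 \<Longrightarrow> \<exists>w. (w, v) \<in> parcs G \<and> f v = f w + 1"
begin

text \<open>By \<open>pred\<close>, every vertex with nonzero value is entered by an arc along which
  \<open>f\<close> rises by exactly one. Tracing such arcs back ends at \<open>u\<close>, the only
  zero of \<open>f\<close>.\<close>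

lemma potential_awalk:
  assumes "v \<in> pverts G"
  shows "\<exists>p. awalk u p v \<and> length p = f v"
  using assms
proof (induct "f v" arbitrary: v)
  case 0
  then have "v = u" using zero by simp
  then show ?case using u 0 by (intro exI[of _ "[]"]) (simp add: awalk_Nil_iff)
next
  case (Suc k)
  then obtain w where w: "(w, v) \<in> parcs G" "f v = f w + 1" using pred by force
  then have "w \<in> pverts G" by (auto dest: in_arcsD1)
  with Suc w obtain p where p: "awalk u p w" "length p = f w" by force
  have "awalk w [(w, v)] v" using w(1) by (auto simp: awalk_simps dest: in_arcsD2)
  with p w(2) show ?case
    by (intro exI[of _ "p @ [(w, v)]"]) (auto intro: awalk_appendI)
qed

text \<open>The descent walk, made into a path, bounds the distance above by \<open>f v\<close>.
  Since \<open>f\<close> grows by at most one per arc, no path is shorter.\<close>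

lemma graph_dist_eq_potential:
  assumes v: "v \<in> pverts G"
  shows "graph_dist G u v = f v"
  unfolding graph_dist_def
proof (rule Least_equality)
  obtain p where p: "awalk u p v" "length p = f v" using potential_awalk[OF v] by blast
  let ?q = "awalk_to_apath p"
  have q: "apath u ?q v" using p(1) by (rule apath_awalk_to_apath)
  have "f v \<le> f u + length ?q"
    using q lip by (intro awalk_potential_le) (auto simp: apath_def)
  moreover have "f u = 0" using zero[OF u] by simp
  moreover have "length ?q \<le> length p" using p(1) by (rule length_awalk_to_apath_le)
  ultimately have "length ?q = f v" using p(2) by simp
  then show "\<exists>p. apath u p v \<and> length p = f v" using q by blast
next
  fix k assume "\<exists>p. apath u p v \<and> length p = k"
  then obtain p where p: "apath u p v" "length p = k" by blast
  have "f v \<le> f u + length p"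
    using p(1) lip by (intro awalk_potential_le) (auto simp: apath_def)
  then show "f v \<le> k" using p(2) zero[OF u] by simp
qed

lemma potential_reachable:
  assumes "v \<in> pverts G"
  shows "u \<rightarrow>\<^sup>*\<^bsub>with_proj G\<^esub> v"
  using potential_awalk[OF assms] reachable_awalk by blast

end

text \<open>\<open>connected\<close> speaks of the symmetric closure of the arcs, which contains the
  arcs themselves, so directed reachability suffices.\<close>

lemma connectedI_reachable:
  assumes "pverts G \<noteq> {}"
    and "\<And>u v. u \<in> pverts G \<Longrightarrow> v \<in> pverts G \<Longrightarrow> u \<rightarrow>\<^sup>*\<^bsub>with_proj G\<^esub> v"
  shows "Digraph_Component.connected (with_proj G)"
  unfolding connected_conv
proof (intro conjI ballI)
  show "verts (with_proj G) \<noteq> {}" using assms(1) by simp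
  fix u v assume "u \<in> verts (with_proj G)" "v \<in> verts (with_proj G)"
  then have "(u, v) \<in> rtrancl_on (pverts G) (parcs G)"
    using assms(2)[of u v] by (simp add: reachable_def)
  then show "(u, v) \<in> rtrancl_on (verts (with_proj G)) ((arcs_ends (with_proj G))\<^sup>s)"
    by (auto intro: rtrancl_on_mono simp: symcl_def)
qed

end

section \<open>Distance to zero in a cycle\<close>

text \<open>The distance from 0 to the class of \<open>x\<close> in the cycle. It is defined on all
  integers so that it applies directly to differences of coordinates.\<close>

definition cyc_norm :: "nat \<Rightarrow> int \<Rightarrow> nat" where
  "cyc_norm n x = nat (min (x mod int n) (int n - x mod int n))"

lemma mod_succ_int:
  assumes "n > (0::int)" shows "(x + 1) mod n = (if x mod n = n - 1 then 0 else x mod n + 1)"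
proof -
  have "(x + 1) mod n = (x mod n + 1) mod n" by (simp add: mod_simps)
  moreover have "0 \<le> x mod n" "x mod n < n" using assms by auto
  ultimately show ?thesis by auto
qed

lemma mod_pred_int:
  assumes "n > (0::int)" shows "(x - 1) mod n = (if x mod n = 0 then n - 1 else x mod n - 1)"
proof -
  have "(x - 1) mod n = (x mod n - 1) mod n" by (simp add: mod_simps)
  moreover have "0 \<le> x mod n" "x mod n < n" using assms by auto
  moreover have "(0 - 1) mod n = n - 1" using assms by (simp add: zmod_minus1)
  ultimately show ?thesis by auto
qed

lemma cyc_norm_cong: "[x = y] (mod int n) \<Longrightarrow> cyc_norm n x = cyc_norm n y"
  by (simp add: cyc_norm_def cong_def)

lemma cyc_norm_mod [simp]: "cyc_norm n (x mod int n) = cyc_norm n x"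
  by (simp add: cyc_norm_def)

context
  fixes n :: nat
  assumes n: "n > 0"
begin

private lemma int_pos: "0 < int n"
  using n by simp

private lemma residue_bounds: "0 \<le> x mod int n" "x mod int n < int n"
  using n by auto

lemma cyc_norm_eq_0_iff: "cyc_norm n x = 0 \<longleftrightarrow> int n dvd x"
  using residue_bounds[of x] unfolding cyc_norm_def dvd_eq_mod_eq_0 by linarith

lemma cyc_norm_minus [simp]: "cyc_norm n (- x) = cyc_norm n x"
  using residue_bounds[of x] unfolding cyc_norm_def zmod_zminus1_eq_if
  by (simp add: min.commute)

lemma cyc_norm_le: "2 * cyc_norm n x \<le> n"
  using residue_bounds[of x] unfolding cyc_norm_def by linarith

lemma cyc_norm_add_1_le: "cyc_norm n (x + 1) \<le> cyc_norm n x + 1"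
  using residue_bounds[of x] unfolding cyc_norm_def mod_succ_int[OF int_pos]
  by (cases "x mod int n = int n - 1") simp_all

lemma cyc_norm_diff_1_le: "cyc_norm n (x - 1) \<le> cyc_norm n x + 1"
  using cyc_norm_add_1_le[of "- x"] cyc_norm_minus[of "x - 1"] by simp

text \<open>Every nonzero residue has a neighbour nearer to 0: the preceding one in the first half
  of the cycle, the following one in the second half. This yields the descent in the product
  graph.\<close>

lemma cyc_norm_step:
  assumes "cyc_norm n x \<noteq> 0"
  shows "cyc_norm n x = cyc_norm n (x - 1) + 1 \<or> cyc_norm n x = cyc_norm n (x + 1) + 1"
proof (cases "2 * (x mod int n) \<le> int n")
  case True
  then have "cyc_norm n x = cyc_norm n (x - 1) + 1"
    using assms residue_bounds[of x]
    unfolding cyc_norm_def mod_pred_int[OF int_pos] by (simp split: if_splits)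
  then show ?thesis ..
next
  case False
  then have "cyc_norm n x = cyc_norm n (x + 1) + 1"
    using assms residue_bounds[of x]
    unfolding cyc_norm_def mod_succ_int[OF int_pos]
    by (cases "x mod int n = int n - 1") auto
  then show ?thesis ..
qed

lemma cyc_norm_of_small: "0 \<le> x \<Longrightarrow> 2 * x \<le> int n \<Longrightarrow> cyc_norm n x = nat x"
  using n by (simp add: cyc_norm_def)

end

section \<open>Kronecker squares of odd cycles\<close>

text \<open>Adjacency becomes a pair of integer congruences, so that wrapping around at the end of
  the cycle needs no separate case later.\<close>

lemma cycle_arc_iff:
  assumes "0 < n"
  shows "(i, j) \<in> parcs (cycle_graph n) \<longleftrightarrow>
    i < n \<and> j < n \<and> ([int j = int i + 1] (mod int n) \<or> [int j = int i - 1] (mod int n))"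
proof -
  have succ: "a = Suc b mod n \<longleftrightarrow> [int a = int b + 1] (mod int n)" if "a < n" for a b
  proof -
    have "a = Suc b mod n \<longleftrightarrow> a mod n = Suc b mod n" using that by simp
    also have "\<dots> \<longleftrightarrow> [int a = int (Suc b)] (mod int n)"
      unfolding cong_int_iff by (simp add: cong_def)
    finally show ?thesis by (simp add: add.commute)
  qed
  have "[int i = int j + 1] (mod int n) \<longleftrightarrow> [int j = int i - 1] (mod int n)"
    unfolding cong_iff_dvd_diff by (subst dvd_minus_iff[symmetric]) (simp add: algebra_simps)
  then show ?thesis using succ by (auto simp: cycle_graph_def)
qed

section \<open>Rotated coordinates and the candidate for the distance\<close>

locale odd_cycle =
  fixes n :: nat
  assumes odd_n: "odd n" and n_ge: "n \<ge> 5"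
begin

text \<open>\<open>h\<close> is the inverse of 2 modulo \<open>n\<close>.\<close>

definition h :: int where "h = (int n + 1) div 2"

lemma double_h: "2 * h = int n + 1"
  using odd_n unfolding h_def by simp presburger

lemma n_pos: "0 < n" using n_ge by simp

text \<open>\<open>X\<close> and \<open>Y\<close> are coordinate differences. As \<open>h\<close> is
  one half modulo \<open>n\<close>, the arguments of \<open>cyc_norm\<close> are the rotated
  coordinates (X + Y)/2 and (X - Y)/2.\<close>

definition kdist :: "int \<Rightarrow> int \<Rightarrow> nat" where
  "kdist X Y = cyc_norm n (h * (X + Y)) + cyc_norm n (h * (X - Y))"

lemma kdist_cong:
  assumes "[X = X'] (mod int n)" "[Y = Y'] (mod int n)"
  shows "kdist X Y = kdist X' Y'"
  unfolding kdist_def using assms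
  by (intro arg_cong2[where f = "(+)"] cyc_norm_cong cong_mult cong_add cong_diff cong_refl)

lemma cyc_norm_half_add: "cyc_norm n (h * (t + 2)) = cyc_norm n (h * t + 1)"
proof (rule cyc_norm_cong)
  have "h * (t + 2) - (h * t + 1) = int n" using double_h by (simp add: algebra_simps)
  then show "[h * (t + 2) = h * t + 1] (mod int n)" by (simp add: cong_iff_dvd_diff)
qed

lemma cyc_norm_half_diff: "cyc_norm n (h * (t - 2)) = cyc_norm n (h * t - 1)"
proof (rule cyc_norm_cong)
  have "h * (t - 2) - (h * t - 1) = - int n" using double_h by (simp add: algebra_simps)
  then show "[h * (t - 2) = h * t - 1] (mod int n)" by (simp add: cong_iff_dvd_diff)
qed

text \<open>A diagonal step changes just one of \<open>X + Y\<close> and \<open>X - Y\<close>, and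
  by 2 in absolute value; after halving, one rotated coordinate moves by 1 and the other
  stays.\<close>

lemma kdist_shift:
  "kdist (X + 1) (Y + 1) = cyc_norm n (h * (X + Y) + 1) + cyc_norm n (h * (X - Y))"
  "kdist (X - 1) (Y - 1) = cyc_norm n (h * (X + Y) - 1) + cyc_norm n (h * (X - Y))"
  "kdist (X + 1) (Y - 1) = cyc_norm n (h * (X + Y)) + cyc_norm n (h * (X - Y) + 1)"
  "kdist (X - 1) (Y + 1) = cyc_norm n (h * (X + Y)) + cyc_norm n (h * (X - Y) - 1)"
  using cyc_norm_half_add[of "X + Y"] cyc_norm_half_diff[of "X + Y"]
    cyc_norm_half_add[of "X - Y"] cyc_norm_half_diff[of "X - Y"]
  unfolding kdist_def by (simp_all add: algebra_simps)

text \<open>The sum and the difference of the rotated coordinates are \<open>2 * h * X\<close> and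
  \<open>2 * h * Y\<close>, congruent to \<open>X\<close> and \<open>Y\<close>, so the rotation has
  trivial kernel.\<close>

lemma kdist_eq_0_iff: "kdist X Y = 0 \<longleftrightarrow> int n dvd X \<and> int n dvd Y"
proof
  assume "kdist X Y = 0"
  then have A: "int n dvd h * (X + Y)" and B: "int n dvd h * (X - Y)"
    using n_pos by (simp_all add: kdist_def cyc_norm_eq_0_iff)
  have "h * (X + Y) + h * (X - Y) = (2 * h) * X" "h * (X + Y) - h * (X - Y) = (2 * h) * Y"
    by (simp_all add: algebra_simps)
  with A B have "int n dvd int n * X + X" "int n dvd int n * Y + Y"
    unfolding double_h by (metis dvd_add dvd_diff distrib_right mult_1)+
  then show "int n dvd X \<and> int n dvd Y" by (simp add: dvd_add_right_iff)
next
  assume "int n dvd X \<and> int n dvd Y"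
  then show "kdist X Y = 0"
    using n_pos by (simp add: kdist_def cyc_norm_eq_0_iff)
qed

lemma kdist_minus: "kdist (- X) (- Y) = kdist X Y"
  using cyc_norm_minus[OF n_pos, of "h * (X + Y)"] cyc_norm_minus[OF n_pos, of "h * (X - Y)"]
  by (simp add: kdist_def algebra_simps)

lemma kdist_le: "kdist X Y \<le> n - 1"
proof -
  \<comment> \<open>The left side is even and at most the odd number \<open>n\<close>, hence at most
    \<open>n - 1\<close>.\<close>
  have "2 * cyc_norm n t \<le> n - 1" for t
    using cyc_norm_le[OF n_pos, of t] odd_n
    by (metis One_nat_def Suc_pred dvd_triv_left le_SucE n_pos)
  from this[of "h * (X + Y)"] this[of "h * (X - Y)"] show ?thesis by (simp add: kdist_def)
qed

section \<open>The product as a simple graph\<close>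

abbreviation G :: "(nat \<times> nat) pair_pre_digraph" where
  "G \<equiv> cycle_graph n \<otimes>\<^sub>K cycle_graph n"

lemma pverts_G: "pverts G = {0..<n} \<times> {0..<n}"
  by (simp add: kronecker_product_def cycle_graph_def)

lemma parcs_G_iff: "((x, y), (x', y')) \<in> parcs G \<longleftrightarrow>
    (x, x') \<in> parcs (cycle_graph n) \<and> (y, y') \<in> parcs (cycle_graph n)"
  by (simp add: kronecker_product_def)

lemma cycle_arc_sym: "(i, j) \<in> parcs (cycle_graph n) \<Longrightarrow> (j, i) \<in> parcs (cycle_graph n)"
  by (auto simp: cycle_graph_def)

lemma cycle_arc_not_refl: "(i, i) \<notin> parcs (cycle_graph n)"
  using n_ge by (auto simp: cycle_graph_def mod_Suc split: if_splits)

lemma cycle_arc_bounds: "(i, j) \<in> parcs (cycle_graph n) \<Longrightarrow> i < n \<and> j < n"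
  by (auto simp: cycle_graph_def)

lemma pair_graph_G: "pair_graph G"
proof unfold_locales
  show fst: "fst e \<in> pverts G" if "e \<in> parcs G" for e
    using that by (cases e) (auto simp: parcs_G_iff pverts_G dest: cycle_arc_bounds)
  show snd: "snd e \<in> pverts G" if "e \<in> parcs G" for e
    using that by (cases e) (auto simp: parcs_G_iff pverts_G dest: cycle_arc_bounds)
  show "finite (pverts G)" by (simp add: pverts_G)
  then show "finite (parcs G)"
    using fst snd by (intro finite_subset[of "parcs G" "pverts G \<times> pverts G"]) (auto simp: mem_Times_iff)
  show "symmetric G"
    by (auto simp: symmetric_def sym_def parcs_G_iff dest: cycle_arc_sym)
  show "fst e \<noteq> snd e" if "e \<in> parcs G" for e
    using that by (cases e) (auto simp: parcs_G_iff cycle_arc_not_refl)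
qed

sublocale pair_graph G by (rule pair_graph_G)

section \<open>Graph distance in rotated coordinates\<close>

definition vdist :: "nat \<times> nat \<Rightarrow> nat \<times> nat \<Rightarrow> nat" where
  "vdist u v = kdist (int (fst v) - int (fst u)) (int (snd v) - int (snd u))"

lemma vdist_eq_0_iff:
  assumes "u \<in> pverts G" "v \<in> pverts G"
  shows "vdist u v = 0 \<longleftrightarrow> v = u"
proof -
  have "int n dvd int a - int b \<longleftrightarrow> a = b" if "a < n" "b < n" for a b
    using that by (auto simp: cong_iff_dvd_diff[symmetric] cong_int_iff cong_def)
  then show ?thesis
    using assms by (auto simp: vdist_def kdist_eq_0_iff pverts_G prod_eq_iff)
qed

text \<open>Along an arc the difference vector makes, modulo \<open>n\<close>, one of the four
  diagonal steps, so only one rotated coordinate moves, and by 1.\<close>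

lemma vdist_arc_le:
  assumes "(v, w) \<in> parcs G"
  shows "vdist u w \<le> vdist u v + 1"
proof -
  obtain x y x' y' where vw: "v = (x, y)" "w = (x', y')" by (cases v, cases w)
  define X where "X = int x - int (fst u)"
  define Y where "Y = int y - int (snd u)"
  have "[int x' - int (fst u) = X + 1] (mod int n) \<or> [int x' - int (fst u) = X - 1] (mod int n)"
    using assms unfolding vw parcs_G_iff cycle_arc_iff[OF n_pos] X_def cong_iff_dvd_diff
    by (auto simp: algebra_simps)
  moreover have "[int y' - int (snd u) = Y + 1] (mod int n) \<or> [int y' - int (snd u) = Y - 1] (mod int n)"
    using assms unfolding vw parcs_G_iff cycle_arc_iff[OF n_pos] Y_def cong_iff_dvd_diff
    by (auto simp: algebra_simps)
  moreover have "kdist (X + 1) (Y + 1) \<le> kdist X Y + 1" "kdist (X + 1) (Y - 1) \<le> kdist X Y + 1"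
    "kdist (X - 1) (Y + 1) \<le> kdist X Y + 1" "kdist (X - 1) (Y - 1) \<le> kdist X Y + 1"
    using cyc_norm_add_1_le[OF n_pos] cyc_norm_diff_1_le[OF n_pos]
    unfolding kdist_shift by (simp_all add: kdist_def)
  ultimately show ?thesis
    unfolding vdist_def vw by (auto dest: kdist_cong simp: X_def Y_def)
qed

text \<open>Some rotated coordinate is nonzero; \<open>cyc_norm_step\<close> moves it towards 0, and
  this move is one of the four diagonal steps.\<close>

lemma vdist_predecessor:
  assumes "v \<in> pverts G" "vdist u v \<noteq> 0"
  shows "\<exists>w. (w, v) \<in> parcs G \<and> vdist u v = vdist u w + 1"
proof -
  obtain x y where v: "v = (x, y)" "x < n" "y < n" using assms(1) by (auto simp: pverts_G)
  define X where "X = int x - int (fst u)"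
  define Y where "Y = int y - int (snd u)"
  have XY: "vdist u v = kdist X Y" by (simp add: vdist_def v X_def Y_def)
  with assms(2) have "cyc_norm n (h * (X + Y)) \<noteq> 0 \<or> cyc_norm n (h * (X - Y)) \<noteq> 0"
    by (simp add: kdist_def)
  then have "kdist X Y = kdist (X + 1) (Y + 1) + 1 \<or> kdist X Y = kdist (X - 1) (Y - 1) + 1 \<or>
    kdist X Y = kdist (X + 1) (Y - 1) + 1 \<or> kdist X Y = kdist (X - 1) (Y + 1) + 1"
    unfolding kdist_shift
    using cyc_norm_step[OF n_pos, of "h * (X + Y)"] cyc_norm_step[OF n_pos, of "h * (X - Y)"]
    by (auto simp: kdist_def)
  then obtain s t where st: "s = 1 \<or> s = -1" "t = 1 \<or> t = -1"
    "kdist X Y = kdist (X + s) (Y + t) + 1"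
    by (metis diff_conv_add_uminus)
  \<comment> \<open>The step may leave the range of the vertices, so the neighbour is taken as the
    reduced representative.\<close>
  define x' where "x' = nat ((int x + s) mod int n)"
  define y' where "y' = nat ((int y + t) mod int n)"
  have x': "int x' = (int x + s) mod int n" and y': "int y' = (int y + t) mod int n"
    using n_pos by (simp_all add: x'_def y'_def)
  have "x' < n" "y' < n" using x' y' n_pos by (simp_all add: x'_def y'_def nat_less_iff)
  moreover have cx: "[int x' = int x + s] (mod int n)" and cy: "[int y' = int y + t] (mod int n)"
    using x' y' by (simp_all add: cong_def)
  ultimately have "((x, y), (x', y')) \<in> parcs G"
    using st v unfolding parcs_G_iff cycle_arc_iff[OF n_pos] by auto
  then have arc: "((x', y'), v) \<in> parcs G"
    unfolding v parcs_G_iff by (blast intro: cycle_arc_sym)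
  have "vdist u (x', y') = kdist (X + s) (Y + t)"
    unfolding vdist_def X_def Y_def
    using cong_diff[OF cx cong_refl, of "int (fst u)"] cong_diff[OF cy cong_refl, of "int (snd u)"]
    by (intro kdist_cong) (simp_all add: algebra_simps)
  with arc XY st(3) show ?thesis by metis
qed

lemma graph_dist_G:
  assumes "u \<in> pverts G" "v \<in> pverts G"
  shows "graph_dist G u v = vdist u v"
proof (rule graph_dist_eq_potential[of u "vdist u"])
  show "vdist u w = 0 \<longleftrightarrow> w = u" if "w \<in> pverts G" for w
    using assms(1) that by (rule vdist_eq_0_iff)
qed (use assms vdist_arc_le vdist_predecessor in blast)+

lemma connected_G: "Digraph_Component.connected (with_proj G)"
proof (rule connectedI_reachable)
  show "pverts G \<noteq> {}" using n_pos by (simp add: pverts_G)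
  fix u v assume uv: "u \<in> pverts G" "v \<in> pverts G"
  show "u \<rightarrow>\<^sup>*\<^bsub>with_proj G\<^esub> v"
  proof (rule potential_reachable[of u "vdist u"])
    show "vdist u w = 0 \<longleftrightarrow> w = u" if "w \<in> pverts G" for w
      using uv(1) that by (rule vdist_eq_0_iff)
  qed (use uv vdist_arc_le vdist_predecessor in blast)+
qed

section \<open>Diameter and failure of distance-regularity\<close>

lemma graph_diameter_G: "graph_diameter G = n - 1"
  unfolding graph_diameter_def
proof (rule Max_eqI)
  have "{graph_dist G u v | u v. u \<in> pverts G \<and> v \<in> pverts G} \<subseteq> {..n - 1}"
    using graph_dist_G kdist_le by (auto simp: vdist_def)
  then show "finite {graph_dist G u v | u v. u \<in> pverts G \<and> v \<in> pverts G}"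
    and "\<And>k. k \<in> {graph_dist G u v | u v. u \<in> pverts G \<and> v \<in> pverts G} \<Longrightarrow> k \<le> n - 1"
    by (blast intro: finite_subset)+
  have in_G: "(0, 0) \<in> pverts G" "(n - 1, 0) \<in> pverts G" using n_pos by (auto simp: pverts_G)
  \<comment> \<open>Both rotated coordinates of (n - 1, 0) are -h, which is congruent to h - 1 = (n
    - 1)/2, the largest value of \<open>cyc_norm\<close>. So this vertex attains the bound.\<close>
  have "[h * (int n - 1) = h - 1] (mod int n)"
  proof -
    have "h * (int n - 1) - (h - 1) = int n * (h - 1)"
      using double_h by (simp add: algebra_simps)
    then show ?thesis by (simp add: cong_iff_dvd_diff)
  qed
  then have "cyc_norm n (h * (int n - 1)) = cyc_norm n (h - 1)" by (rule cyc_norm_cong)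
  also have "\<dots> = nat (h - 1)"
    using double_h n_ge by (intro cyc_norm_of_small) auto
  finally have "vdist (0, 0) (n - 1, 0) = 2 * nat (h - 1)"
    using n_pos by (simp add: vdist_def kdist_def of_nat_diff)
  also have "\<dots> = n - 1" using double_h n_ge by linarith
  finally have "graph_dist G (0, 0) (n - 1, 0) = n - 1" using graph_dist_G[OF in_G] by simp
  then show "n - 1 \<in> {graph_dist G u v | u v. u \<in> pverts G \<and> v \<in> pverts G}"
    using in_G by (metis (mono_tags, lifting) mem_Collect_eq)
qed

lemma not_distance_regular_G: "\<not> distance_regular G"
proof
  assume "distance_regular G"
  then obtain c where c: "\<forall>x\<in>pverts G. \<forall>y\<in>pverts G. graph_dist G x y = 2 \<longrightarrow>
      card (neighbors G y \<inter> dist_layer G (int 2 - 1) x) = c"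
    unfolding distance_regular_def by metis
  define S where "S y = neighbors G y \<inter> dist_layer G 1 (0, 0)" for y
  have in_G: "(0, 0) \<in> pverts G" "(2, 0) \<in> pverts G" "(2, 2) \<in> pverts G"
      "(1, 1) \<in> pverts G" "(1, n - 1) \<in> pverts G"
    using n_ge by (auto simp: pverts_G)
  have finS: "finite (S y)" for y
    unfolding S_def dist_layer_def by (rule finite_subset[OF _ pair_finite_verts]) auto
  \<comment> \<open>These give (2, 0) the rotated coordinates (1, 1), and (2, 2) the rotated
    coordinates (2, 0). Both vertices thus lie at distance 2, and the count c_2 is to be compared at
    them.\<close>
  have "h * 2 = 1 + int n * 1" "h * 4 = 2 + int n * 2" using double_h by simp_all
  then have "[h * 2 = 1] (mod int n)" "[h * 4 = 2] (mod int n)"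
    by (metis cong_def mod_mult_self2)+
  then have c24: "cyc_norm n (h * 2) = 1" "cyc_norm n (h * 4) = 2"
    using cyc_norm_of_small[OF n_pos, of 1] cyc_norm_of_small[OF n_pos, of 2] n_ge
    by (auto dest!: cyc_norm_cong)
  have c0: "cyc_norm n 0 = 0" using n_pos by (simp add: cyc_norm_eq_0_iff)
  have "graph_dist G (0, 0) (2, 0) = 2" "graph_dist G (0, 0) (2, 2) = 2"
    using in_G c24 c0 by (simp_all add: graph_dist_G vdist_def kdist_def)
  with c in_G have eq: "card (S (2, 0)) = card (S (2, 2))" by (simp add: S_def)
  have layer1: "((0, 0), v) \<in> parcs G" if "v \<in> dist_layer G 1 (0, 0)" for v
  proof -
    from that have v: "v \<in> pverts G" "vdist (0, 0) v = 1"
      using in_G by (auto simp: dist_layer_def graph_dist_G)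
    then obtain w where w: "(w, v) \<in> parcs G" "vdist (0, 0) w = 0"
      using vdist_predecessor[of v "(0, 0)"] by auto
    moreover have "w \<in> pverts G" using w(1) by (auto dest: in_arcsD1)
    ultimately show ?thesis using in_G vdist_eq_0_iff by metis
  qed
  \<comment> \<open>A vertex of this set is a common neighbour of (0, 0) and (2, 2). As n is at
    least 5, the only common neighbour of 0 and 2 in the cycle is 1.\<close>
  have "S (2, 2) \<subseteq> {(1, 1)}"
  proof
    fix v assume v: "v \<in> S (2, 2)"
    obtain x y where xy: "v = (x, y)" by (cases v)
    have "z = 1" if "(0, z) \<in> parcs (cycle_graph n)" "(2, z) \<in> parcs (cycle_graph n)" for z
      using that n_ge by (auto simp: cycle_graph_def mod_Suc split: if_splits)
    then show "v \<in> {(1, 1)}"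
      using v layer1[of v] unfolding xy S_def neighbors_def by (auto simp: parcs_G_iff)
  qed
  then have "card (S (2, 2)) \<le> 1"
    using card_mono[of "{(1, 1)}" "S (2, 2)"] by simp
  \<comment> \<open>Here the second coordinate only has to be a neighbour of 0, which leaves two
    choices.\<close>
  moreover have "{(1, 1), (1, n - 1)} \<subseteq> S (2, 0)"
  proof -
    have a: "(0, Suc 0) \<in> parcs (cycle_graph n)" "(0, n - 1) \<in> parcs (cycle_graph n)"
      "(2, Suc 0) \<in> parcs (cycle_graph n)"
      using n_ge by (auto simp: cycle_graph_def)
    have "v \<in> S (2, 0)" if "v \<in> pverts G" "((0, 0), v) \<in> parcs G" "((2, 0), v) \<in> parcs G" for v
    proof -
      have "vdist (0, 0) v \<le> vdist (0, 0) (0, 0) + 1" by (rule vdist_arc_le) fact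
      moreover have "vdist (0, 0) (0, 0) = 0" using in_G vdist_eq_0_iff by blast
      moreover have "v \<noteq> (0, 0)" using that(2) pair_no_loops by fastforce
      then have "vdist (0, 0) v \<noteq> 0" using in_G that(1) vdist_eq_0_iff by blast
      ultimately have "graph_dist G (0, 0) v = 1" using in_G that(1) by (simp add: graph_dist_G)
      then show ?thesis using that by (simp add: S_def dist_layer_def neighbors_def)
    qed
    then show ?thesis using a in_G by (simp add: parcs_G_iff)
  qed
  then have "card {(1::nat, 1), (1::nat, n - 1)} \<le> card (S (2, 0))" by (rule card_mono[OF finS])
  moreover have "card {(1::nat, 1), (1::nat, n - 1)} = 2" using n_ge by (simp add: card_insert_if)
  ultimately show False using eq by simp
qed

section \<open>Fourier transforms modulo n\<close>

abbreviation Z :: "int set" where "Z \<equiv> {0..<int n}"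

lemma sum_shift:
  fixes f :: "int \<Rightarrow> 'b::comm_monoid_add"
  assumes "\<And>x. f (x mod int n) = f x"
  shows "(\<Sum>x\<in>Z. f (x + t)) = (\<Sum>x\<in>Z. f x)"
proof (rule sum.reindex_bij_witness[of _ "\<lambda>x. (x - t) mod int n" "\<lambda>x. (x + t) mod int n"])
  fix x assume "x \<in> Z"
  then show "((x + t) mod int n - t) mod int n = x" "((x - t) mod int n + t) mod int n = x"
    by (simp_all add: mod_simps)
qed (use n_pos assms in auto)

text \<open>The map (u, v) to (u + v, u - v) permutes the pairs of residues because 2 is invertible;
  multiplication by \<open>h\<close> gives the inverse.\<close>

lemma sum_half_rotation:
  fixes f :: "int \<Rightarrow> int \<Rightarrow> 'b::comm_monoid_add"
  assumes "\<And>x y. f (x mod int n) (y mod int n) = f x y"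
  shows "(\<Sum>u\<in>Z. \<Sum>v\<in>Z. f (u + v) (u - v)) = (\<Sum>x\<in>Z. \<Sum>y\<in>Z. f x y)"
proof -
  have half: "h * (2 * x) mod int n = x" if "x \<in> Z" for x
  proof -
    have "h * (2 * x) = x + int n * x" using double_h by (simp add: algebra_simps)
    then show ?thesis using that by simp
  qed
  have mod_add: "(h * (a mod int n + b mod int n)) mod int n = h * (a + b) mod int n"
    and mod_diff: "(h * (a mod int n - b mod int n)) mod int n = h * (a - b) mod int n" for a b
    by (metis mod_add_eq mod_mult_right_eq) (metis mod_diff_eq mod_mult_right_eq)
  have half_sum: "(h * a mod int n + h * b mod int n) mod int n = h * (a + b) mod int n"
    and half_diff: "(h * a mod int n - h * b mod int n) mod int n = h * (a - b) mod int n" for a b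
    by (simp_all add: mod_simps algebra_simps)
  have "(\<Sum>(u, v)\<in>Z \<times> Z. f (u + v) (u - v)) = (\<Sum>(x, y)\<in>Z \<times> Z. f x y)"
  proof (rule sum.reindex_bij_witness[of _
        "\<lambda>(x, y). (h * (x + y) mod int n, h * (x - y) mod int n)"
        "\<lambda>(u, v). ((u + v) mod int n, (u - v) mod int n)"])
    fix p assume p: "p \<in> Z \<times> Z"
    obtain x y where xy: "p = (x, y)" "x \<in> Z" "y \<in> Z" using p by blast
    have "(x + y) + (x - y) = 2 * x" "(x + y) - (x - y) = 2 * y" by simp_all
    then show "(case case p of (u, v) \<Rightarrow> ((u + v) mod int n, (u - v) mod int n) of
        (x, y) \<Rightarrow> (h * (x + y) mod int n, h * (x - y) mod int n)) = p"
      "(case case p of (x, y) \<Rightarrow> (h * (x + y) mod int n, h * (x - y) mod int n) of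
        (u, v) \<Rightarrow> ((u + v) mod int n, (u - v) mod int n)) = p"
      using half xy by (simp_all add: mod_add mod_diff half_sum half_diff)
  qed (use n_pos assms in auto)
  then show ?thesis by (simp add: sum.cartesian_product)
qed

section \<open>Characters modulo n\<close>

definition chr :: "int \<Rightarrow> complex" where
  "chr k = cis (2 * pi * of_int k / of_nat n)"

lemma chr_add: "chr (k + l) = chr k * chr l"
  by (simp add: chr_def cis_mult add_divide_distrib distrib_left)

lemma chr_0 [simp]: "chr 0 = 1"
  by (simp add: chr_def)

lemma chr_minus_mult [simp]: "chr k * chr (- k) = 1"
  by (simp flip: chr_add)

lemma chr_eq_1_iff: "chr k = 1 \<longleftrightarrow> int n dvd k"
proof
  assume "chr k = 1"
  then have "cos (2 * pi * of_int k / of_nat n) = 1" by (simp add: chr_def complex_eq_iff)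
  then obtain j :: int where "2 * pi * of_int k / of_nat n = of_int j * 2 * pi"
    by (auto simp: cos_one_2pi_int)
  then have "(of_int k :: real) = of_int (j * int n)"
    using n_pos by (simp add: field_simps)
  then have "k = j * int n" by (simp only: of_int_eq_iff)
  then show "int n dvd k" by simp
next
  assume "int n dvd k"
  then obtain j where "k = int n * j" by blast
  then have "chr k = cis (2 * pi * of_int j)"
    unfolding chr_def using n_pos by (intro arg_cong[where f = cis]) simp
  then show "chr k = 1" by (metis Ints_of_int cis_multiple_2pi)
qed

lemma chr_cong:
  assumes "[k = l] (mod int n)"
  shows "chr k = chr l"
proof -
  have "chr k = chr l * chr (k - l)" by (simp flip: chr_add)
  moreover have "chr (k - l) = 1" using assms by (simp add: chr_eq_1_iff cong_iff_dvd_diff)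
  ultimately show ?thesis by simp
qed

lemma chr_mod_right [simp]: "chr (k * (x mod int n)) = chr (k * x)"
  by (rule chr_cong) (simp add: cong_def mod_simps)

text \<open>Shifting the summation variable by 1 multiplies the sum by \<open>chr k\<close>. If this
  factor is not 1, the sum vanishes.\<close>

lemma sum_chr: "(\<Sum>x\<in>Z. chr (k * x)) = (if int n dvd k then of_nat n else 0)"
proof (cases "int n dvd k")
  case True
  then have "chr (k * x) = 1" for x by (simp add: chr_eq_1_iff)
  then show ?thesis using True by simp
next
  case False
  have "(\<Sum>x\<in>Z. chr (k * x)) = (\<Sum>x\<in>Z. chr (k * (x + 1)))"
    by (rule sum_shift[symmetric]) simp
  also have "\<dots> = (\<Sum>x\<in>Z. chr (k * x)) * chr k"
    by (simp add: distrib_left chr_add sum_distrib_right)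
  finally have "(\<Sum>x\<in>Z. chr (k * x)) * (chr k - 1) = 0" by (simp add: algebra_simps)
  then show ?thesis using False by (simp add: chr_eq_1_iff)
qed

section \<open>Fourier transform of the distance to zero in the cycle\<close>

definition norm_transform :: "int \<Rightarrow> complex" where
  "norm_transform k = (\<Sum>x\<in>Z. of_nat (cyc_norm n x) * chr (k * x))"

lemma norm_transform_cong: "[k = l] (mod int n) \<Longrightarrow> norm_transform k = norm_transform l"
  unfolding norm_transform_def
  by (intro sum.cong refl arg_cong2[where f = "(*)"] chr_cong cong_mult) simp_all

lemma norm_transform_shift:
  "(\<Sum>x\<in>Z. of_nat (cyc_norm n (x + t)) * chr (k * x)) = chr (- (k * t)) * norm_transform k"
proof -
  have "(\<Sum>x\<in>Z. of_nat (cyc_norm n (x + t)) * chr (k * x)) =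
      (\<Sum>x\<in>Z. of_nat (cyc_norm n (x + t)) * chr (k * (x + t)) * chr (- (k * t)))"
    by (intro sum.cong refl) (simp add: mult.assoc distrib_left flip: chr_add)
  also have "\<dots> = (\<Sum>x\<in>Z. of_nat (cyc_norm n x) * chr (k * x) * chr (- (k * t)))"
    by (rule sum_shift) simp
  finally show ?thesis by (simp add: norm_transform_def mult.commute flip: sum_distrib_left)
qed

text \<open>Around the cycle \<open>cyc_norm\<close> rises with slope 1 up to \<open>h - 1\<close>,
  is level from there to \<open>h\<close>, and falls with slope 1 back to 0. Only the corners
  contribute. The form \<open>x + - 1\<close> fits \<open>norm_transform_shift\<close>.\<close>

lemma cyc_norm_second_difference:
  assumes "x \<in> Z"
  shows "int (cyc_norm n (x + 1)) + int (cyc_norm n (x + - 1)) - 2 * int (cyc_norm n x) =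
    (if x = 0 then 2 else 0) - (if x = h - 1 then 1 else 0) - (if x = h then 1 else 0)"
proof -
  have c: "int (cyc_norm n y) = min y (int n - y)" if "0 \<le> y" "y < int n" for y
    using that by (simp add: cyc_norm_def)
  have "x = 0 \<or> x = int n - 1 \<or> 0 < x \<and> x < int n - 1" using assms by auto
  then consider "x = 0" | "x = int n - 1" | "0 < x" "x < int n - 1" by blast
  then show ?thesis
  proof cases
    case 1
    have "cyc_norm n (- 1) = cyc_norm n 1" using cyc_norm_minus[OF n_pos, of 1] by simp
    then show ?thesis using 1 c[of 0] c[of 1] double_h n_ge by simp
  next
    case 2
    have "cyc_norm n (int n) = 0" using n_pos by (simp add: cyc_norm_eq_0_iff)
    then show ?thesis using 2 c[of "int n - 1"] c[of "int n - 2"] double_h n_ge by simp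
  next
    case 3
    have "x < h - 1 \<or> x = h - 1 \<or> x = h \<or> h < x" by linarith
    then show ?thesis
      using 3 c[of x] c[of "x + 1"] c[of "x + - 1"] double_h by (elim disjE) simp_all
  qed
qed

text \<open>The second difference multiplies the transform at \<open>2 a\<close> by \<open>(s - 2) (s + 2)\<close> with
  \<open>s = 2 cos (2 pi a / n)\<close>, and its own transform at \<open>2 a\<close> is \<open>2 - s\<close>.\<close>

lemma norm_transform_double:
  assumes a: "\<not> int n dvd a"
  shows "norm_transform (2 * a) = of_real (- 1 / (2 + 2 * cos (2 * pi * of_int a / of_nat n)))"
proof -
  let ?k = "2 * a"
  let ?s = "chr a + chr (- a)"
  have hZ: "h \<in> Z" "h - 1 \<in> Z" using double_h n_ge by auto
  have "(\<Sum>x\<in>Z. of_int (int (cyc_norm n (x + 1)) + int (cyc_norm n (x + - 1))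
        - 2 * int (cyc_norm n x)) * chr (?k * x)) =
      (chr (- (?k * 1)) + chr (- (?k * - 1)) - 2) * norm_transform ?k"
    unfolding ring_distribs
    by (subst norm_transform_shift[symmetric])+
      (simp add: norm_transform_def algebra_simps sum.distrib sum_subtractf sum_distrib_left)
  moreover have "(\<Sum>x\<in>Z. of_int (int (cyc_norm n (x + 1)) + int (cyc_norm n (x + - 1))
        - 2 * int (cyc_norm n x)) * chr (?k * x)) =
      (\<Sum>x\<in>Z. (if x = 0 then 2 * chr (?k * x) else 0) - (if x = h - 1 then chr (?k * x) else 0)
        - (if x = h then chr (?k * x) else 0))"
    by (intro sum.cong refl, subst cyc_norm_second_difference) (auto simp: algebra_simps)
  moreover have "\<dots> = 2 - chr (?k * (h - 1)) - chr (?k * h)"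
    using hZ n_pos by (simp add: sum_subtractf)
  \<comment> \<open>The even frequency \<open>2 * a\<close> cancels the half in \<open>h\<close>, so
    the two corners near n/2 contribute \<open>chr a\<close> and \<open>chr (- a)\<close>.\<close>
  moreover have "chr (?k * h) = chr a"
  proof (rule chr_cong)
    have "?k * h = a + int n * a" using double_h by (simp add: algebra_simps)
    then show "[?k * h = a] (mod int n)" by (simp add: cong_def)
  qed
  moreover have "chr (?k * (h - 1)) = chr (- a)"
  proof (rule chr_cong)
    have "?k * (h - 1) = - a + int n * a" using double_h by (simp add: algebra_simps)
    then show "[?k * (h - 1) = - a] (mod int n)" by (metis cong_def mod_mult_self2)
  qed
  ultimately have eq: "(chr ?k + chr (- ?k) - 2) * norm_transform ?k = 2 - chr (- a) - chr a"
    by (simp add: add.commute)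
  \<comment> \<open>Since \<open>chr a * chr (- a) = 1\<close>, the square of \<open>?s\<close> is
    \<open>chr ?k + chr (- ?k) + 2\<close>.\<close>
  have "chr (?k) + chr (- ?k) - 2 = (?s - 2) * (?s + 2)"
  proof -
    have "chr ?k = chr a * chr a" "chr (- ?k) = chr (- a) * chr (- a)"
      by (simp_all flip: chr_add)
    moreover have "(?s - 2) * (?s + 2) =
        chr a * chr a + chr (- a) * chr (- a) + 2 * (chr a * chr (- a)) - 4"
      by (simp add: algebra_simps del: chr_minus_mult)
    ultimately show ?thesis by simp
  qed
  note eq = eq[unfolded this]
  have "(?s - 2) * ((?s + 2) * norm_transform ?k + 1) =
      (?s - 2) * (?s + 2) * norm_transform ?k + (?s - 2)"
    by (simp only: distrib_left[of "?s - 2" "(?s + 2) * norm_transform ?k"] mult.assoc mult_1_right)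
  also have "\<dots> = 0" unfolding eq by simp
  finally have "(?s - 2) * ((?s + 2) * norm_transform ?k + 1) = 0" .
  moreover have s: "?s = of_real (2 * cos (2 * pi * of_int a / of_nat n))"
    by (simp add: chr_def complex_eq_iff)
  moreover have "cos (2 * pi * of_int a / of_nat n) \<noteq> 1"
  proof
    assume c: "cos (2 * pi * of_int a / of_nat n) = 1"
    then have "sin (2 * pi * of_int a / of_nat n) = 0"
      by (simp add: cos_one_sin_zero)
    with c have "chr a = 1" by (simp add: chr_def complex_eq_iff)
    with a show False by (simp add: chr_eq_1_iff)
  qed
  \<comment> \<open>This allows the common factor \<open>?s - 2\<close> to be cancelled.\<close>
  then have "?s - 2 \<noteq> 0" unfolding s
    by (metis eq_iff_diff_eq_0 mult_cancel_left1 of_real_eq_iff of_real_numeral zero_neq_numeral)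
  ultimately have e: "(?s + 2) * norm_transform ?k = - 1"
    by (simp add: eq_neg_iff_add_eq_0)
  \<comment> \<open>A product equal to -1 has no zero factor, so dividing is legitimate.\<close>
  moreover from e have "?s + 2 \<noteq> 0" by auto
  ultimately have "norm_transform ?k = - 1 / (?s + 2)" by (simp add: field_simps)
  then show ?thesis unfolding s by (simp add: add.commute)
qed

section \<open>Fourier transform of the distance in the product\<close>

definition kron_transform :: "int \<Rightarrow> int \<Rightarrow> complex" where
  "kron_transform a b = (\<Sum>x\<in>Z. \<Sum>y\<in>Z. of_nat (kdist x y) * chr (a * x + b * y))"

lemma kdist_mod [simp]: "kdist (x mod int n) (y mod int n) = kdist x y"
  by (rule kdist_cong) (simp_all add: cong_def)

lemma kdist_half_rotation: "kdist (u + v) (u - v) = cyc_norm n u + cyc_norm n v"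
proof -
  have "cyc_norm n (h * (2 * x)) = cyc_norm n x" for x
  proof (rule cyc_norm_cong)
    have "h * (2 * x) = x + int n * x" using double_h by (simp add: algebra_simps)
    then show "[h * (2 * x) = x] (mod int n)" by (simp add: cong_def)
  qed
  moreover have "(u + v) + (u - v) = 2 * u" "(u + v) - (u - v) = 2 * v" by simp_all
  ultimately show ?thesis unfolding kdist_def by simp
qed

text \<open>In the variables u, v with x = u + v and y = u - v, the distance is a sum of two norms
  and the character a product with frequencies \<open>a + b\<close> and \<open>a - b\<close>. In
  each of the two terms one variable carries only a character, and \<open>sum_chr\<close> evaluates
  its sum.\<close>

lemma kron_transform_eq:
  "kron_transform a b =
    (if int n dvd a - b then of_nat n * norm_transform (a + b) else 0) +
    (if int n dvd a + b then of_nat n * norm_transform (a - b) else 0)"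
proof -
  have "kron_transform a b =
      (\<Sum>u\<in>Z. \<Sum>v\<in>Z. of_nat (kdist (u + v) (u - v)) * chr (a * (u + v) + b * (u - v)))"
    unfolding kron_transform_def
    by (rule sum_half_rotation[symmetric]) (simp add: chr_add)
  also have "\<dots> = (\<Sum>u\<in>Z. \<Sum>v\<in>Z.
      of_nat (cyc_norm n u) * chr ((a + b) * u) * chr ((a - b) * v) +
      chr ((a + b) * u) * (of_nat (cyc_norm n v) * chr ((a - b) * v)))"
  proof (intro sum.cong refl)
    fix u v
    have "a * (u + v) + b * (u - v) = (a + b) * u + (a - b) * v" by (simp add: algebra_simps)
    then have "chr (a * (u + v) + b * (u - v)) = chr ((a + b) * u) * chr ((a - b) * v)"
      by (simp only: chr_add)
    then show "of_nat (kdist (u + v) (u - v)) * chr (a * (u + v) + b * (u - v)) =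
      of_nat (cyc_norm n u) * chr ((a + b) * u) * chr ((a - b) * v) +
      chr ((a + b) * u) * (of_nat (cyc_norm n v) * chr ((a - b) * v))"
      by (simp add: kdist_half_rotation algebra_simps)
  qed
  also have "\<dots> = norm_transform (a + b) * (\<Sum>v\<in>Z. chr ((a - b) * v)) +
      (\<Sum>u\<in>Z. chr ((a + b) * u)) * norm_transform (a - b)"
    unfolding sum.distrib norm_transform_def sum_product ..
  finally show ?thesis by (simp add: sum_chr)
qed

end

section \<open>Distance eigenvalues\<close>

text \<open>Eigenvectors are turned into functions on the vertices, which removes the enumeration
  \<open>vs\<close> from all further arguments.\<close>

lemma distance_eigenvalues_iff:
  assumes "vertex_enumeration G vs"
  shows "k \<in> distance_eigenvalues G vs \<longleftrightarrow>
    (\<exists>f. (\<exists>u\<in>pverts G. f u \<noteq> 0) \<and>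
      (\<forall>u\<in>pverts G. (\<Sum>v\<in>pverts G. real (graph_dist G u v) * f v) = k * f u))"
proof -
  let ?A = "distance_matrix G vs" and ?N = "length vs"
  have vs: "distinct vs" "set vs = pverts G"
    using assms by (auto simp: vertex_enumeration_def)
  have dim: "dim_row ?A = ?N" by (simp add: distance_matrix_def)
  have sum_nth: "(\<Sum>j = 0..<?N. g (vs ! j)) = (\<Sum>v\<in>pverts G. g v)" for g :: "'a \<Rightarrow> real"
    using vs by (metis atLeast0LessThan sum.reindex_bij_betw bij_betw_nth)
  have row: "(?A *\<^sub>v w) $ i = (\<Sum>j = 0..<?N. real (graph_dist G (vs ! i) (vs ! j)) * w $ j)"
    if "i < ?N" "dim_vec w = ?N" for i w
    using that by (simp add: distance_matrix_def scalar_prod_def)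
  have "eigenvector ?A w k \<longleftrightarrow>
      w \<in> carrier_vec ?N \<and> (\<exists>i<?N. w $ i \<noteq> 0) \<and>
      (\<forall>i<?N. (\<Sum>j = 0..<?N. real (graph_dist G (vs ! i) (vs ! j)) * w $ j) = k * w $ i)" for w
  proof (cases "w \<in> carrier_vec ?N")
    case True
    then have "?A *\<^sub>v w = k \<cdot>\<^sub>v w \<longleftrightarrow>
        (\<forall>i<?N. (\<Sum>j = 0..<?N. real (graph_dist G (vs ! i) (vs ! j)) * w $ j) = k * w $ i)"
      using row dim by (auto simp: vec_eq_iff)
    moreover have "w \<noteq> 0\<^sub>v ?N \<longleftrightarrow> (\<exists>i<?N. w $ i \<noteq> 0)" using True by (auto simp: vec_eq_iff)
    ultimately show ?thesis using True by (simp add: eigenvector_def dim)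
  qed (simp add: eigenvector_def dim)
  note ev = this
  show ?thesis
  proof
    assume "k \<in> distance_eigenvalues G vs"
    then obtain w where w: "w \<in> carrier_vec ?N" "\<exists>i<?N. w $ i \<noteq> 0"
      "\<And>i. i < ?N \<Longrightarrow> (\<Sum>j = 0..<?N. real (graph_dist G (vs ! i) (vs ! j)) * w $ j) = k * w $ i"
      by (auto simp: distance_eigenvalues_def eigenvalue_def ev)
    \<comment> \<open>The description picks the index of \<open>v\<close> in \<open>vs\<close>,
      unique for vertices because \<open>vs\<close> is distinct.\<close>
    define f where "f v = w $ (THE i. i < ?N \<and> vs ! i = v)" for v
    have f: "f (vs ! i) = w $ i" if "i < ?N" for i
    proof -
      have "(THE j. j < ?N \<and> vs ! j = vs ! i) = i"
        using that vs(1) by (auto simp: nth_eq_iff_index_eq)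
      then show ?thesis by (simp add: f_def)
    qed
    have "(\<Sum>v\<in>pverts G. real (graph_dist G u v) * f v) = k * f u" if "u \<in> pverts G" for u
    proof -
      have "u \<in> set vs" using that vs(2) by simp
      then obtain i where i: "i < ?N" "u = vs ! i" by (auto simp: in_set_conv_nth)
      have "(\<Sum>v\<in>pverts G. real (graph_dist G u v) * f v) =
          (\<Sum>j = 0..<?N. real (graph_dist G u (vs ! j)) * f (vs ! j))"
        by (rule sum_nth[symmetric])
      also have "\<dots> = k * f u" using w(3) i f by simp
      finally show ?thesis .
    qed
    moreover have "\<exists>u\<in>pverts G. f u \<noteq> 0"
    proof -
      from w(2) obtain i where "i < ?N" "w $ i \<noteq> 0" by blast
      then have "vs ! i \<in> pverts G" "f (vs ! i) \<noteq> 0" using f vs(2) nth_mem[of i vs] by simp_all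
      then show ?thesis by blast
    qed
    ultimately show "\<exists>f. (\<exists>u\<in>pverts G. f u \<noteq> 0) \<and>
      (\<forall>u\<in>pverts G. (\<Sum>v\<in>pverts G. real (graph_dist G u v) * f v) = k * f u)" by blast
  next
    assume "\<exists>f. (\<exists>u\<in>pverts G. f u \<noteq> 0) \<and>
      (\<forall>u\<in>pverts G. (\<Sum>v\<in>pverts G. real (graph_dist G u v) * f v) = k * f u)"
    then obtain f where f: "\<exists>u\<in>pverts G. f u \<noteq> 0"
      "\<forall>u\<in>pverts G. (\<Sum>v\<in>pverts G. real (graph_dist G u v) * f v) = k * f u" by blast
    have "eigenvector ?A (vec ?N (\<lambda>i. f (vs ! i))) k"
      unfolding ev
    proof (intro conjI allI impI)
      show "\<exists>i<?N. vec ?N (\<lambda>i. f (vs ! i)) $ i \<noteq> 0"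
      proof -
        obtain i where "i < ?N" "f (vs ! i) \<noteq> 0"
          using f(1) unfolding vs(2)[symmetric] by (auto simp: in_set_conv_nth)
        then have "vec ?N (\<lambda>i. f (vs ! i)) $ i \<noteq> 0" by simp
        with \<open>i < ?N\<close> show ?thesis by blast
      qed
      fix i assume i: "i < ?N"
      then have "(\<Sum>v\<in>pverts G. real (graph_dist G (vs ! i) v) * f v) = k * f (vs ! i)"
        using f(2) vs(2) by (metis nth_mem)
      then show "(\<Sum>j = 0..<?N. real (graph_dist G (vs ! i) (vs ! j)) * vec ?N (\<lambda>i. f (vs ! i)) $ j) =
          k * vec ?N (\<lambda>i. f (vs ! i)) $ i"
        using i sum_nth[of "\<lambda>v. real (graph_dist G (vs ! i) v) * f v"] by simp
    qed simp
    then show "k \<in> distance_eigenvalues G vs"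
      by (auto simp: distance_eigenvalues_def eigenvalue_def)
  qed
qed

context odd_cycle
begin

section \<open>Characters of the vertex group as eigenvectors\<close>

definition vchr :: "int \<Rightarrow> int \<Rightarrow> nat \<times> nat \<Rightarrow> complex" where
  "vchr a b v = chr (a * int (fst v) + b * int (snd v))"

lemma sum_pverts_G:
  fixes F :: "int \<Rightarrow> int \<Rightarrow> 'b::comm_monoid_add"
  shows "(\<Sum>v\<in>pverts G. F (int (fst v)) (int (snd v))) = (\<Sum>x\<in>Z. \<Sum>y\<in>Z. F x y)"
proof -
  have "(\<Sum>v\<in>pverts G. F (int (fst v)) (int (snd v))) = (\<Sum>(x, y)\<in>Z \<times> Z. F x y)"
    unfolding pverts_G
    by (rule sum.reindex_bij_witness[of _ "\<lambda>(x, y). (nat x, nat y)" "\<lambda>(i, j). (int i, int j)"])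
      auto
  then show ?thesis by (simp add: sum.cartesian_product)
qed

text \<open>The distance depends only on the difference of the vertices, so the left side is a
  convolution: translating the summation by \<open>u\<close> splits off the value of the character
  at \<open>u\<close>.\<close>

lemma sum_vdist_vchr:
  "(\<Sum>v\<in>pverts G. of_nat (vdist u v) * vchr a b v) = kron_transform a b * vchr a b u"
proof -
  let ?s = "int (fst u)" and ?t = "int (snd u)"
  define g where "g x y = of_nat (kdist x y) * chr (a * x + b * y)" for x y
  \<comment> \<open>Periodicity in each variable separately lets \<open>sum_shift\<close> be applied
    to one coordinate at a time.\<close>
  have g_mod: "g (x mod int n) y = g x y" "g x (y mod int n) = g x y" for x y
    unfolding g_def using kdist_mod[of "x mod int n" y] kdist_mod[of x y] kdist_mod[of x "y mod int n"]
    by (simp_all add: chr_add)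
  have "(\<Sum>v\<in>pverts G. of_nat (vdist u v) * vchr a b v) =
      (\<Sum>x\<in>Z. \<Sum>y\<in>Z. of_nat (kdist (x - ?s) (y - ?t)) * chr (a * x + b * y))"
    unfolding vdist_def vchr_def by (rule sum_pverts_G)
  also have "\<dots> = (\<Sum>x\<in>Z. \<Sum>y\<in>Z. g (x + - ?s) (y + - ?t) * vchr a b u)"
    by (intro sum.cong refl) (simp add: g_def vchr_def mult.assoc algebra_simps flip: chr_add)
  also have "\<dots> = (\<Sum>x\<in>Z. \<Sum>y\<in>Z. g (x + - ?s) (y + - ?t)) * vchr a b u"
    by (simp add: sum_distrib_right)
  also have "(\<Sum>x\<in>Z. \<Sum>y\<in>Z. g (x + - ?s) (y + - ?t)) = (\<Sum>x\<in>Z. \<Sum>y\<in>Z. g (x + - ?s) y)"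
    by (intro sum.cong refl sum_shift) (rule g_mod)
  also have "\<dots> = (\<Sum>x\<in>Z. \<Sum>y\<in>Z. g x y)"
    by (rule sum_shift) (simp add: g_mod)
  finally show ?thesis by (simp add: kron_transform_def g_def)
qed

lemma vdist_commute: "vdist u v = vdist v u"
  unfolding vdist_def
  using kdist_minus[of "int (fst v) - int (fst u)" "int (snd v) - int (snd u)"] by simp

text \<open>Fourier inversion: the coefficients of \<open>f\<close>, weighted by the inverse
  characters at \<open>u\<close> and summed over all frequencies, give n^2 times
  \<open>f u\<close>.\<close>

lemma vchr_complete:
  fixes f :: "nat \<times> nat \<Rightarrow> complex"
  assumes f: "\<And>a b. (\<Sum>v\<in>pverts G. f v * vchr a b v) = 0" and u: "u \<in> pverts G"
  shows "f u = 0"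
proof -
  have orth: "(\<Sum>a\<in>Z. \<Sum>b\<in>Z. chr (- (a * int (fst u) + b * int (snd u))) * vchr a b v) =
      (if v = u then of_nat n * of_nat n else 0)" if v: "v \<in> pverts G" for v
  proof -
    let ?X = "int (fst v) - int (fst u)" and ?Y = "int (snd v) - int (snd u)"
    have "(\<Sum>a\<in>Z. \<Sum>b\<in>Z. chr (- (a * int (fst u) + b * int (snd u))) * vchr a b v) =
        (\<Sum>a\<in>Z. \<Sum>b\<in>Z. chr (?X * a) * chr (?Y * b))"
      unfolding vchr_def by (intro sum.cong refl) (simp add: algebra_simps flip: chr_add)
    also have "\<dots> = (\<Sum>a\<in>Z. chr (?X * a)) * (\<Sum>b\<in>Z. chr (?Y * b))"
      by (simp add: sum_product)
    also have "\<dots> = (if int n dvd ?X \<and> int n dvd ?Y then of_nat n * of_nat n else 0)"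
      by (simp add: sum_chr)
    also have "int n dvd ?X \<and> int n dvd ?Y \<longleftrightarrow> v = u"
      using vdist_eq_0_iff[OF u v] by (simp add: vdist_def kdist_eq_0_iff)
    finally show ?thesis .
  qed
  have "0 = (\<Sum>a\<in>Z. \<Sum>b\<in>Z. chr (- (a * int (fst u) + b * int (snd u))) *
      (\<Sum>v\<in>pverts G. f v * vchr a b v))"
    by (simp add: f)
  also have "\<dots> = (\<Sum>a\<in>Z. \<Sum>b\<in>Z. \<Sum>v\<in>pverts G. f v *
      (chr (- (a * int (fst u) + b * int (snd u))) * vchr a b v))"
    by (simp add: sum_distrib_left algebra_simps)
  also have "\<dots> = (\<Sum>a\<in>Z. \<Sum>v\<in>pverts G. \<Sum>b\<in>Z. f v *
      (chr (- (a * int (fst u) + b * int (snd u))) * vchr a b v))"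
    by (intro sum.cong refl sum.swap)
  also have "\<dots> = (\<Sum>v\<in>pverts G. \<Sum>a\<in>Z. \<Sum>b\<in>Z. f v *
      (chr (- (a * int (fst u) + b * int (snd u))) * vchr a b v))"
    by (rule sum.swap)
  also have "\<dots> = (\<Sum>v\<in>pverts G. f v * (if v = u then of_nat n * of_nat n else 0))"
    by (intro sum.cong refl) (simp only: orth flip: sum_distrib_left)
  also have "\<dots> = f u * (of_nat n * of_nat n)"
    using u pair_finite_verts by (simp add: if_distrib cong: if_cong)
  finally show ?thesis using n_pos by simp
qed

lemma distance_eigenvalue_iff_kron_transform:
  assumes vs: "vertex_enumeration G vs"
    and real: "\<And>a b. kron_transform a b \<in> \<real>"
  shows "k \<in> distance_eigenvalues G vs \<longleftrightarrow> (\<exists>a b. kron_transform a b = of_real k)"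
proof
  assume "k \<in> distance_eigenvalues G vs"
  then obtain f u where u: "u \<in> pverts G" "f u \<noteq> 0" and
    f: "\<And>u. u \<in> pverts G \<Longrightarrow> (\<Sum>v\<in>pverts G. real (graph_dist G u v) * f v) = k * f u"
    using distance_eigenvalues_iff[OF vs] by auto
  \<comment> \<open>The distance is taken from \<open>v\<close> to \<open>u\<close>, by symmetry, so
    that summing over \<open>u\<close> first produces \<open>kron_transform\<close>.\<close>
  have fc: "(\<Sum>v\<in>pverts G. of_nat (vdist v u) * complex_of_real (f v)) = of_real k * of_real (f u)"
    if u: "u \<in> pverts G" for u
  proof -
    have "(\<Sum>v\<in>pverts G. real (vdist v u) * f v) = k * f u"
      using f[OF u] u by (simp add: graph_dist_G vdist_commute[of _ u])
    from arg_cong[OF this, of complex_of_real] show ?thesis by simp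
  qed
  \<comment> \<open>A nonzero eigenfunction has a nonzero coefficient \<open>?S\<close>. Computing
    \<open>of_real k * ?S\<close> in two ways then identifies \<open>k\<close> with the transform at
    that frequency.\<close>
  from vchr_complete[of "\<lambda>v. of_real (f v)", OF _ u(1)] u(2)
  obtain a b where ab: "(\<Sum>v\<in>pverts G. of_real (f v) * vchr a b v) \<noteq> 0" (is "?S \<noteq> 0") by auto
  have "of_real k * ?S = (\<Sum>u\<in>pverts G. (of_real k * of_real (f u)) * vchr a b u)"
    by (simp add: sum_distrib_left mult.assoc)
  also have "\<dots> = (\<Sum>u\<in>pverts G. \<Sum>v\<in>pverts G. of_real (f v) * (of_nat (vdist v u) * vchr a b u))"
    by (intro sum.cong refl, subst fc[symmetric]) (simp_all add: sum_distrib_right sum_distrib_left mult_ac)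
  also have "\<dots> = (\<Sum>v\<in>pverts G. \<Sum>u\<in>pverts G. of_real (f v) * (of_nat (vdist v u) * vchr a b u))"
    by (rule sum.swap)
  also have "\<dots> = (\<Sum>v\<in>pverts G. of_real (f v) * (kron_transform a b * vchr a b v))"
    by (simp add: sum_vdist_vchr flip: sum_distrib_left)
  also have "\<dots> = kron_transform a b * ?S"
    by (simp add: sum_distrib_left algebra_simps)
  finally show "\<exists>a b. kron_transform a b = of_real k" using ab by auto
next
  assume "\<exists>a b. kron_transform a b = of_real k"
  then obtain a b where ab: "kron_transform a b = of_real k" by blast
  \<comment> \<open>The eigenvalue is real, so the real part of the character is again an
    eigenfunction; it is nonzero because its value at (0, 0) is 1.\<close>
  have "(\<Sum>v\<in>pverts G. real (graph_dist G u v) * Re (vchr a b v)) = k * Re (vchr a b u)"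
    if u: "u \<in> pverts G" for u
  proof -
    have "(\<Sum>v\<in>pverts G. real (graph_dist G u v) * Re (vchr a b v)) =
        Re (\<Sum>v\<in>pverts G. of_nat (vdist u v) * vchr a b v)"
      using u by (simp add: graph_dist_G)
    then show ?thesis by (simp add: sum_vdist_vchr ab)
  qed
  moreover have "(0, 0) \<in> pverts G" "Re (vchr a b (0, 0)) \<noteq> 0"
    using n_pos by (auto simp: pverts_G vchr_def)
  ultimately show "k \<in> distance_eigenvalues G vs"
    using distance_eigenvalues_iff[OF vs] by (auto intro!: exI[of _ "\<lambda>v. Re (vchr a b v)"])
qed

section \<open>The spectrum in closed form and its size\<close>

definition cycle_eigenvalue :: "int \<Rightarrow> real" where
  "cycle_eigenvalue a = - real n / (2 + 2 * cos (2 * pi * of_int a / of_nat n))"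

text \<open>The sum of the distances from one vertex, that is, the constant row sum of the distance
  matrix.\<close>

definition transmission :: real where
  "transmission = 2 * real n * (\<Sum>x\<in>Z. real (cyc_norm n x))"

lemma dvd_double_iff: "int n dvd 2 * a \<longleftrightarrow> int n dvd a"
proof
  assume "int n dvd 2 * a"
  then have "int n dvd h * (2 * a)" by simp
  also have "h * (2 * a) = int n * a + a" using double_h by (simp add: algebra_simps)
  finally show "int n dvd a" by (simp add: dvd_add_right_iff)
qed simp

text \<open>On either axis the surviving frequency, \<open>a + b\<close> or \<open>a - b\<close>, is
  congruent to \<open>2 * a\<close>, where \<open>norm_transform_double\<close> applies. On both
  axes at once it is 0, and the two terms add up to \<open>transmission\<close>.\<close>

lemma kron_transform_cases:
  "kron_transform a b =
    (if int n dvd a - b \<and> int n dvd a + b then of_real transmission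
     else if int n dvd a - b \<or> int n dvd a + b then of_real (cycle_eigenvalue a) else 0)"
proof -
  have c: "of_nat n * norm_transform c = of_real (cycle_eigenvalue a)" if "[c = 2 * a] (mod int n)" "\<not> int n dvd a" for c
    using norm_transform_cong[OF that(1)] norm_transform_double[OF that(2)] by (simp add: cycle_eigenvalue_def)
  have plus: "[a + b = 2 * a] (mod int n)" if "int n dvd a - b"
  proof -
    have "2 * a - (a + b) = a - b" by simp
    then show ?thesis using that by (metis cong_iff_dvd_diff cong_sym)
  qed
  have minus: "[a - b = 2 * a] (mod int n)" if "int n dvd a + b"
  proof -
    have "2 * a - (a - b) = a + b" by simp
    then show ?thesis using that by (metis cong_iff_dvd_diff cong_sym)
  qed
  \<comment> \<open>If \<open>n\<close> divided \<open>a\<close>, both conditions would say that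
    \<open>n\<close> divides \<open>b\<close>. So off the origin \<open>a\<close> is nonzero modulo
    \<open>n\<close>.\<close>
  have single: "\<not> int n dvd a" if "(int n dvd a - b) \<noteq> (int n dvd a + b)"
  proof
    assume "int n dvd a"
    then have "int n dvd a - b \<longleftrightarrow> int n dvd b" "int n dvd a + b \<longleftrightarrow> int n dvd b"
      by (simp_all add: dvd_add_right_iff dvd_diff_right_iff)
    with that show False by simp
  qed
  have zero: "of_nat n * norm_transform 0 + of_nat n * norm_transform 0 = of_real transmission"
    by (simp add: norm_transform_def transmission_def)
  consider "int n dvd a - b" "int n dvd a + b" | "int n dvd a - b" "\<not> int n dvd a + b"
    | "\<not> int n dvd a - b" "int n dvd a + b" | "\<not> int n dvd a - b" "\<not> int n dvd a + b"
    by blast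
  then show ?thesis
  proof cases
    case 1
    then have "norm_transform (a + b) = norm_transform 0" "norm_transform (a - b) = norm_transform 0"
      by (auto intro!: norm_transform_cong simp: cong_0_iff)
    then have "kron_transform a b = of_real transmission"
      unfolding kron_transform_eq using 1 zero by simp
    then show ?thesis using 1 by simp
  next
    case 2
    then show ?thesis unfolding kron_transform_eq using c[OF plus single] by simp
  next
    case 3
    then show ?thesis unfolding kron_transform_eq using c[OF minus single] by simp
  qed (simp add: kron_transform_eq)
qed

definition spectrum :: "real set" where
  "spectrum = insert transmission (insert 0 (cycle_eigenvalue ` {1..int n div 2}))"

lemma cycle_eigenvalue_minus: "cycle_eigenvalue (- a) = cycle_eigenvalue a"
  by (simp add: cycle_eigenvalue_def)

lemma cycle_eigenvalue_cong: "[a = b] (mod int n) \<Longrightarrow> cycle_eigenvalue a = cycle_eigenvalue b"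
proof -
  assume "[a = b] (mod int n)"
  then have "Re (chr a) = Re (chr b)" by (metis chr_cong)
  then show ?thesis by (simp add: cycle_eigenvalue_def chr_def)
qed

text \<open>The value depends only on the residue of \<open>a\<close> up to sign, and every nonzero
  residue is, up to sign, one of the numbers from 1 to (n - 1)/2.\<close>

lemma cycle_eigenvalue_in_spectrum:
  assumes "\<not> int n dvd a"
  shows "cycle_eigenvalue a \<in> cycle_eigenvalue ` {1..int n div 2}"
proof -
  define r where "r = a mod int n"
  have "0 \<le> r" "r \<noteq> 0" "r < int n"
    using assms n_pos unfolding r_def dvd_eq_mod_eq_0 by simp_all
  moreover have "cycle_eigenvalue a = cycle_eigenvalue r" by (rule cycle_eigenvalue_cong) (simp add: r_def cong_def)
  ultimately have r: "0 < r" "r < int n" "cycle_eigenvalue a = cycle_eigenvalue r" by simp_all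
  show ?thesis
  proof (cases "r \<le> int n div 2")
    case True
    then show ?thesis using r by auto
  next
    case False
    have "cycle_eigenvalue r = cycle_eigenvalue (- r)" by (simp add: cycle_eigenvalue_minus)
    also have "\<dots> = cycle_eigenvalue (int n - r)" by (rule cycle_eigenvalue_cong) (simp add: cong_iff_dvd_diff)
    finally show ?thesis using r False by (intro image_eqI[of _ _ "int n - r"]) auto
  qed
qed

lemma distance_eigenvalues_G:
  assumes "vertex_enumeration G vs"
  shows "distance_eigenvalues G vs = spectrum"
proof -
  have "(\<exists>a b. kron_transform a b = of_real k) \<longleftrightarrow> k \<in> spectrum" for k
  proof
    assume "\<exists>a b. kron_transform a b = of_real k"
    then obtain a b where ab: "kron_transform a b = of_real k" by blast
    \<comment> \<open>With \<open>n\<close> dividing \<open>a\<close>, either axis condition implies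
      the other. Hence a frequency on exactly one axis satisfies the hypothesis of
      \<open>cycle_eigenvalue_in_spectrum\<close>.\<close>
    have "int n dvd a - b" if "int n dvd a" "int n dvd a + b"
      using that by (metis dvd_add_right_iff dvd_diff)
    moreover have "int n dvd a + b" if "int n dvd a" "int n dvd a - b"
      using that by (metis dvd_diff_right_iff dvd_add)
    ultimately show "k \<in> spectrum"
      using ab cycle_eigenvalue_in_spectrum[of a] unfolding kron_transform_cases spectrum_def
      by (auto split: if_splits)
  next
    assume "k \<in> spectrum"
    then consider "k = transmission" | "k = 0" | a where "k = cycle_eigenvalue a" "1 \<le> a" "a \<le> int n div 2"
      unfolding spectrum_def by auto
    \<comment> \<open>Witnesses: the origin, the frequency (1, 0) off both axes, and (a, a) on one
      axis.\<close>
    then show "\<exists>a b. kron_transform a b = of_real k"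
    proof cases
      case 1
      then have "kron_transform 0 0 = of_real k" by (simp add: kron_transform_cases)
      then show ?thesis by blast
    next
      case 2
      have "\<not> int n dvd 1" using n_ge by simp
      with 2 have "kron_transform 1 0 = of_real k" by (simp add: kron_transform_cases)
      then show ?thesis by blast
    next
      case 3
      then have "\<not> int n dvd 2 * a" using n_ge by (auto simp: dvd_double_iff dest!: zdvd_imp_le)
      with 3 have "kron_transform a a = of_real k" by (simp add: kron_transform_cases)
      then show ?thesis by blast
    qed
  qed
  moreover have "kron_transform a b \<in> \<real>" for a b
    by (simp add: kron_transform_cases)
  ultimately show ?thesis
    using distance_eigenvalue_iff_kron_transform[OF assms] by auto
qed

text \<open>The angles lie strictly between 0 and pi, where the cosine is injective and above -1.
  The (n - 1)/2 values are therefore distinct and negative; 0 and the positive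
  \<open>transmission\<close> add two more.\<close>

lemma card_spectrum: "card spectrum = (n + 3) div 2"
proof -
  have range: "0 < 2 * pi * of_int a / of_nat n \<and> 2 * pi * of_int a / of_nat n < pi"
    if "a \<in> {1..int n div 2}" for a
  proof -
    \<comment> \<open>Oddness makes this strict, which keeps the angle away from pi, where the
      denominator would vanish.\<close>
    have "2 * a < int n" using that odd_n by auto presburger
    then have "2 * real_of_int a < real n" by linarith
    then show ?thesis using that n_pos by (auto simp: field_simps)
  qed
  have cos: "- 1 < cos (2 * pi * of_int a / of_nat n)" if "a \<in> {1..int n div 2}" for a
    using cos_monotone_0_pi[of "2 * pi * of_int a / of_nat n" pi] range[OF that] by simp
  have neg: "cycle_eigenvalue a < 0" if "a \<in> {1..int n div 2}" for a
    using cos[OF that] n_pos by (simp add: cycle_eigenvalue_def field_simps)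
  have "inj_on cycle_eigenvalue {1..int n div 2}"
  proof (rule inj_onI)
    fix a b assume a: "a \<in> {1..int n div 2}" and b: "b \<in> {1..int n div 2}" and "cycle_eigenvalue a = cycle_eigenvalue b"
    then have cos_eq: "cos (2 * pi * of_int a / of_nat n) = cos (2 * pi * of_int b / of_nat n)"
      using cos[OF a] cos[OF b] n_pos by (simp add: cycle_eigenvalue_def field_simps)
    have "2 * pi * of_int a / of_nat n = 2 * pi * of_int b / of_nat n"
      by (rule cos_inj_pi) (use range[OF a] range[OF b] cos_eq in auto)
    then show "a = b" using n_pos by simp
  qed
  then have "card (cycle_eigenvalue ` {1..int n div 2}) = n div 2" by (simp add: card_image)
  moreover have "transmission > 0"
  proof -
    have "real (cyc_norm n 1) \<le> (\<Sum>x\<in>Z. real (cyc_norm n x))"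
      using n_ge by (intro member_le_sum) auto
    moreover have "cyc_norm n 1 = 1" using n_ge by (simp add: cyc_norm_of_small)
    ultimately show ?thesis using n_pos by (simp add: transmission_def)
  qed
  moreover from this have "0 \<notin> cycle_eigenvalue ` {1..int n div 2}" "transmission \<notin> insert 0 (cycle_eigenvalue ` {1..int n div 2})"
    using neg by force+
  ultimately have "card spectrum = n div 2 + 2" by (simp add: spectrum_def)
  then show ?thesis using odd_n by presburger
qed

end

section \<open>The infinite family\<close>

text \<open>An isomorphism preserves the number of vertices, here a square that determines its
  root.\<close>

lemma kronecker_cycle_digraph_iso_imp_eq:
  assumes "digraph_iso (with_proj (cycle_graph m \<otimes>\<^sub>K cycle_graph m))
    (with_proj (cycle_graph n \<otimes>\<^sub>K cycle_graph n))"
  shows "m = n"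
proof -
  let ?V = "\<lambda>n. pverts (cycle_graph n \<otimes>\<^sub>K cycle_graph n)"
  obtain f where "inj_on f (?V m)" "?V n = f ` ?V m"
    using assms unfolding digraph_iso_def pre_digraph.digraph_isomorphism_def
    by (metis verts_app_iso with_proj_simps(1))
  then have "card (?V n) = card (?V m)" by (simp add: card_image)
  then have "n\<^sup>2 = m\<^sup>2"
    by (simp add: kronecker_product_def cycle_graph_def card_cartesian_product power2_eq_square)
  then show ?thesis by (simp add: power2_eq_iff_nonneg)
qed

lemma infinite_odd_cycle_squares: "infinite odd_cycle_squares"
proof -
  let ?G = "\<lambda>n. cycle_graph n \<otimes>\<^sub>K cycle_graph n"
  have "inj ?G"
  proof (rule injI)
    fix m n assume "?G m = ?G n"
    then have "pverts (?G m) = pverts (?G n)" by simp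
    then have "card ({0..<m} \<times> {0..<m}) = card ({0..<n} \<times> {0..<n})"
      by (simp add: kronecker_product_def cycle_graph_def)
    then have "m\<^sup>2 = n\<^sup>2" by (simp add: card_cartesian_product power2_eq_square)
    then show "m = n" by (simp add: power2_eq_iff_nonneg)
  qed
  \<comment> \<open>The values \<open>2 * k + 5\<close> are odd and at least 5, so they index
    members of the family.\<close>
  moreover have "inj (\<lambda>k::nat. 2 * k + 5)" by (simp add: inj_on_def)
  ultimately have "inj (\<lambda>k. ?G (2 * k + 5))" by (rule inj_compose[unfolded comp_def])
  then have "infinite (range (\<lambda>k. ?G (2 * k + 5)))" by (rule range_inj_infinite)
  moreover have "range (\<lambda>k. ?G (2 * k + 5)) \<subseteq> odd_cycle_squares"
    unfolding odd_cycle_squares_def by force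
  ultimately show ?thesis by (rule infinite_super[rotated])
qed

theorem mainTheorem7:
  shows "(\<forall>n::nat. odd n \<and> n \<ge> 5 \<longrightarrow>
            pair_graph (cycle_graph n \<otimes>\<^sub>K cycle_graph n) \<and>
            Digraph_Component.connected (with_proj (cycle_graph n \<otimes>\<^sub>K cycle_graph n)) \<and>
            graph_diameter (cycle_graph n \<otimes>\<^sub>K cycle_graph n) = n - 1 \<and>
            \<not> distance_regular (cycle_graph n \<otimes>\<^sub>K cycle_graph n) \<and>
            (n + 3) div 2 < n \<and>
            (\<forall>vs. vertex_enumeration (cycle_graph n \<otimes>\<^sub>K cycle_graph n) vs \<longrightarrow>
               card (distance_eigenvalues (cycle_graph n \<otimes>\<^sub>K cycle_graph n) vs) = (n + 3) div 2 \<and>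
               card (distance_eigenvalues (cycle_graph n \<otimes>\<^sub>K cycle_graph n) vs)
                 < graph_diameter (cycle_graph n \<otimes>\<^sub>K cycle_graph n) + 1)) \<and>
         infinite odd_cycle_squares \<and>
         (\<forall>G\<in>odd_cycle_squares. \<forall>H\<in>odd_cycle_squares.
            G \<noteq> H \<longrightarrow> \<not> digraph_iso (with_proj G) (with_proj H)) \<and>
         (\<forall>G\<in>odd_cycle_squares.
            pair_graph G \<and> Digraph_Component.connected (with_proj G) \<and> \<not> distance_regular G \<and>
            (\<forall>vs. vertex_enumeration G vs \<longrightarrow>
               card (distance_eigenvalues G vs) < graph_diameter G + 1))"
proof -
  have main: "pair_graph (cycle_graph n \<otimes>\<^sub>K cycle_graph n) \<and>
      Digraph_Component.connected (with_proj (cycle_graph n \<otimes>\<^sub>K cycle_graph n)) \<and>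
      graph_diameter (cycle_graph n \<otimes>\<^sub>K cycle_graph n) = n - 1 \<and>
      \<not> distance_regular (cycle_graph n \<otimes>\<^sub>K cycle_graph n) \<and>
      (n + 3) div 2 < n \<and>
      (\<forall>vs. vertex_enumeration (cycle_graph n \<otimes>\<^sub>K cycle_graph n) vs \<longrightarrow>
         card (distance_eigenvalues (cycle_graph n \<otimes>\<^sub>K cycle_graph n) vs) = (n + 3) div 2 \<and>
         card (distance_eigenvalues (cycle_graph n \<otimes>\<^sub>K cycle_graph n) vs)
           < graph_diameter (cycle_graph n \<otimes>\<^sub>K cycle_graph n) + 1)"
    if "odd n" "n \<ge> 5" for n
  proof -
    interpret odd_cycle n using that by unfold_locales
    \<comment> \<open>Subtraction on naturals is truncated; the second fact turns the diameter plus
      one into \<open>n\<close>.\<close>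
    have "(n + 3) div 2 < n" "n - 1 + 1 = n" using that by auto
    then show ?thesis
      using pair_graph_G connected_G graph_diameter_G not_distance_regular_G
      by (simp add: distance_eigenvalues_G card_spectrum)
  qed
  show ?thesis
  proof (intro conjI ballI)
    show "\<forall>n::nat. odd n \<and> n \<ge> 5 \<longrightarrow>
            pair_graph (cycle_graph n \<otimes>\<^sub>K cycle_graph n) \<and>
            Digraph_Component.connected (with_proj (cycle_graph n \<otimes>\<^sub>K cycle_graph n)) \<and>
            graph_diameter (cycle_graph n \<otimes>\<^sub>K cycle_graph n) = n - 1 \<and>
            \<not> distance_regular (cycle_graph n \<otimes>\<^sub>K cycle_graph n) \<and>
            (n + 3) div 2 < n \<and>
            (\<forall>vs. vertex_enumeration (cycle_graph n \<otimes>\<^sub>K cycle_graph n) vs \<longrightarrow>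
               card (distance_eigenvalues (cycle_graph n \<otimes>\<^sub>K cycle_graph n) vs) = (n + 3) div 2 \<and>
               card (distance_eigenvalues (cycle_graph n \<otimes>\<^sub>K cycle_graph n) vs)
                 < graph_diameter (cycle_graph n \<otimes>\<^sub>K cycle_graph n) + 1)"
      using main by blast
    show "infinite odd_cycle_squares" by (rule infinite_odd_cycle_squares)
    show "G \<noteq> H \<longrightarrow> \<not> digraph_iso (with_proj G) (with_proj H)"
      if "G \<in> odd_cycle_squares" "H \<in> odd_cycle_squares" for G H
      using that kronecker_cycle_digraph_iso_imp_eq unfolding odd_cycle_squares_def by blast
  qed (use main in \<open>auto simp: odd_cycle_squares_def\<close>)
qed

end
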